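(* Let $p$ be an odd prime, let $\lambda\in\mathbb{C}_p$ with $|\lambda|_p\ge1$, and let $a\in\frac{1}{\lambda}E$. Then \[ -\tanh_\lambda\Big(\frac12:a\Big)=\sum_{n=1}^\infty\mathcal{E}_{n,\lambda}\frac{a^n}{n!}. \]
   Context: $\mathbb{C}_p$ is the completion of an algebraic closure of $\mathbb{Q}_p$, with $|p|_p=1/p$; $\mathbb{Z}_p$ is the ring of $p$-adic integers. Let $E=\{x\in\mathbb{C}_p: |x|_p<p^{-1/(p-1)}\}$ and $\frac{1}{\lambda}E=\{t\in\mathbb{C}_p:\lambda t\in E\}$. Let $\log$ and $\exp$ denote the $p$-adic logarithm and exponential. The generalized falling factorials are $(x)_{0,\lambda}=1$, $(x)_{n,\lambda}=x(x-\lambda)\cdots(x-(n-1)\lambda)$ for $n\ge1$. For $a\in\frac1\lambda E$ and $|x|_p\le|\lambda|_p$, the degenerate exponential is $e^x_\lambda(a)=(1+\lambda a)^{x/\lambda}=\exp\big(\tfrac{x}{\lambda}\log(1+\lambda a)\big)=\sum_{n\ge0}(x)_{n,\lambda}\frac{a^n}{n!}$. The degenerate hyperbolic functions are $\cosh_\lambda(x:a)=\frac12\big(e^x_\lambda(a)+e^{-x}_\lambda(a)\big)$, $\sinh_\lambda(x:a)=\frac12\big(e^x_\lambda(a)-e^{-x}_\lambda(a)\big)$, and $\tanh_\lambda(x:a)=\sinh_\lambda(x:a)/\cosh_\lambda(x:a)$. The fermionic $p$-adic integral of a continuous $f:\mathbb{Z}_p\to\mathbb{C}_p$ is $\int_{\mathbb{Z}_p}f(x)\,d\mu_{-1}(x)=\lim_{N\to\infty}\sum_{x=0}^{p^N-1}f(x)(-1)^x$.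 The degenerate Euler numbers are $\mathcal{E}_{n,\lambda}=\int_{\mathbb{Z}_p}(x)_{n,\lambda}\,d\mu_{-1}(x)$ (equivalently $\frac{2}{e_\lambda(t)+1}=\sum_{n\ge0}\mathcal{E}_{n,\lambda}\frac{t^n}{n!}$ with $e_\lambda(t)=e^1_\lambda(t)$). *)

theory Defs
  imports "HOL-Analysis.Analysis" "HOL-Computational_Algebra.Computational_Algebra"
begin

definition is_subfield :: "'a::field set \<Rightarrow> bool" where
  "is_subfield L \<longleftrightarrow> 1 \<in> L \<and> (\<forall>x\<in>L. \<forall>y\<in>L. x - y \<in> L \<and> x * y \<in> L \<and> inverse x \<in> L)"

definition algebraic_over :: "'a::field set \<Rightarrow> 'a \<Rightarrow> bool" where
  "algebraic_over F x \<longleftrightarrow> (\<exists>f. f \<noteq> 0 \<and> (\<forall>i. coeff f i \<in> F) \<and> poly f x = 0)"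

definition is_algebraic_closure :: "'a::field set \<Rightarrow> 'a set \<Rightarrow> bool" where
  "is_algebraic_closure F L \<longleftrightarrow>
     is_subfield L \<and> F \<subseteq> L \<and> (\<forall>x\<in>L. algebraic_over F x) \<and>
     (\<forall>f. (\<forall>i. coeff f i \<in> L) \<and> degree f > 0 \<longrightarrow> (\<exists>x\<in>L. poly f x = 0))"

class nonarch_complete_field = field_char_0 + complete_space +
  fixes vabs :: "'a \<Rightarrow> real"
  assumes dist_vabs: "dist x y = vabs (x - y)"
    and vabs_mult: "vabs (x * y) = vabs x * vabs y"
    and vabs_add: "vabs (x + y) \<le> max (vabs x) (vabs y)"

text \<open>
  The field of \<open>p\<close>-adic complex numbers is specified up to isometric isomorphism: the type \<open>'a\<close>
  carries a complete non-Archimedean absolute value with \<open>\<bar>p\<bar> = 1/p\<close>, and some algebraic closure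
  of \<open>\<rat>\<^sub>p\<close> is dense in it. By completeness of \<open>'a\<close>, the field \<open>\<rat>\<^sub>p\<close> (the completion of \<open>\<rat>\<close>) is the
  topological closure of \<open>\<rat>\<close>, and a dense subfield has \<open>'a\<close> as its completion. For a prime \<open>p\<close> the
  conditions on \<open>vabs\<close> force it to be the \<open>p\<close>-adic absolute value on \<open>\<rat>\<close>.
\<close>

definition padic_complex :: "nat \<Rightarrow> 'a::nonarch_complete_field itself \<Rightarrow> bool" where
  "padic_complex p T \<longleftrightarrow>
     vabs (of_nat p :: 'a) = 1 / real p \<and>
     (\<exists>L :: 'a set. is_algebraic_closure (closure \<rat>) L \<and> closure L = UNIV)"

definition padic_E :: "nat \<Rightarrow> 'a::nonarch_complete_field set" where
  "padic_E p = {x. vabs x < real p powr (- 1 / (real p - 1))}"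

definition padic_exp :: "'a::nonarch_complete_field \<Rightarrow> 'a" where
  "padic_exp x = (\<Sum>n. x ^ n / fact n)"

definition padic_log :: "'a::nonarch_complete_field \<Rightarrow> 'a" where
  "padic_log x = (\<Sum>n. (- 1) ^ n * (x - 1) ^ Suc n / of_nat (Suc n))"

definition gen_falling :: "'a::nonarch_complete_field \<Rightarrow> nat \<Rightarrow> 'a \<Rightarrow> 'a" where
  "gen_falling x n lam = (\<Prod>i<n. x - of_nat i * lam)"

definition deg_exp :: "'a::nonarch_complete_field \<Rightarrow> 'a \<Rightarrow> 'a \<Rightarrow> 'a" where
  "deg_exp lam x a = padic_exp (x / lam * padic_log (1 + lam * a))"

definition deg_cosh :: "'a::nonarch_complete_field \<Rightarrow> 'a \<Rightarrow> 'a \<Rightarrow> 'a" where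
  "deg_cosh lam x a = 1 / 2 * (deg_exp lam x a + deg_exp lam (- x) a)"

definition deg_sinh :: "'a::nonarch_complete_field \<Rightarrow> 'a \<Rightarrow> 'a \<Rightarrow> 'a" where
  "deg_sinh lam x a = 1 / 2 * (deg_exp lam x a - deg_exp lam (- x) a)"

definition deg_tanh :: "'a::nonarch_complete_field \<Rightarrow> 'a \<Rightarrow> 'a \<Rightarrow> 'a" where
  "deg_tanh lam x a = deg_sinh lam x a / deg_cosh lam x a"

text \<open>
  The integrand is a function on \<open>\<int>\<^sub>p \<subseteq> 'a\<close>; only its values at natural numbers, embedded by
  \<^const>\<open>of_nat\<close>, enter the defining limit.
\<close>

definition fermionic_integral ::
    "nat \<Rightarrow> ('a \<Rightarrow> 'a) \<Rightarrow> 'a::nonarch_complete_field" where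
  "fermionic_integral p f = lim (\<lambda>N. \<Sum>x<p ^ N. f (of_nat x) * (- 1) ^ x)"

definition deg_euler ::
    "nat \<Rightarrow> 'a \<Rightarrow> nat \<Rightarrow> 'a::nonarch_complete_field" where
  "deg_euler p lam n = fermionic_integral p (\<lambda>x. gen_falling x n lam)"

end

theory Submission imports Defs begin

text \<open>
  With \<open>w = e\<^sub>\<lambda>(a)\<close> the binomial series gives \<open>w\<^sup>x = \<Sum>n. (x)\<^sub>n\<^sub>,\<^sub>\<lambda> a\<^sup>n / n!\<close> for natural \<open>x\<close>, so
  summing \<open>(- w)\<^sup>x\<close> over \<open>x < p\<^sup>N\<close> geometrically yields
  \<open>(1 + w ^ (p ^ N)) / (1 + w)\<close>, which tends to \<open>2 / (1 + w)\<close>. Termwise, the alternating sums of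
  \<open>(x)\<^sub>n\<^sub>,\<^sub>\<lambda>\<close> tend to the Euler numbers, and the bound \<open>\<bar>\<lambda> a\<bar>\<^sup>n / \<bar>n!\<bar>\<close>, uniform in \<open>N\<close>,
  permits exchanging limit and sum. Finally \<open>- tanh\<^sub>\<lambda>(1/2 : a) = 2 / (1 + w) - 1\<close>.
\<close>

section \<open>Non-Archimedean absolute values and series\<close>

lemma vabs_zero [simp]: "vabs (0::'a::nonarch_complete_field) = 0"
  using dist_vabs[of "0::'a" 0] by simp

lemma vabs_eq_0_iff [simp]: "vabs (x::'a::nonarch_complete_field) = 0 \<longleftrightarrow> x = 0"
  using dist_vabs[of x 0] by auto

lemma vabs_nonneg [simp]: "0 \<le> vabs (x::'a::nonarch_complete_field)"
  using dist_vabs[of x 0] zero_le_dist[of x 0] by simp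

lemma vabs_pos_iff [simp]: "0 < vabs (x::'a::nonarch_complete_field) \<longleftrightarrow> x \<noteq> 0"
  using vabs_nonneg[of x] vabs_eq_0_iff[of x] by linarith

lemma vabs_one [simp]: "vabs (1::'a::nonarch_complete_field) = 1"
proof -
  have "vabs (1::'a) = vabs (1::'a) * vabs (1::'a)"
    using vabs_mult[of "1::'a" 1] by simp
  thus ?thesis by simp
qed

lemma vabs_minus [simp]: "vabs (- x) = vabs (x::'a::nonarch_complete_field)"
  using dist_vabs[of x 0] dist_vabs[of 0 x] by (simp add: dist_commute)

lemma vabs_diff: "vabs (x - y) \<le> max (vabs x) (vabs (y::'a::nonarch_complete_field))"
  using vabs_add[of x "- y"] by simp

lemma vabs_power: "vabs (x ^ n) = vabs (x::'a::nonarch_complete_field) ^ n"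
  by (induction n) (auto simp: vabs_mult)

lemma vabs_divide: "vabs (x / y) = vabs x / vabs (y::'a::nonarch_complete_field)"
proof (cases "y = 0")
  case False
  hence "vabs (x / y) * vabs y = vabs x"
    using vabs_mult[of "x / y" y] by simp
  thus ?thesis using False by (simp add: field_simps)
qed auto

lemma vabs_of_nat_le_1: "vabs (of_nat n :: 'a::nonarch_complete_field) \<le> 1"
proof (induction n)
  case (Suc n)
  thus ?case using vabs_add[of "1::'a" "of_nat n"] by simp
qed auto

lemma vabs_sum_le:
  fixes f :: "'b \<Rightarrow> 'a::nonarch_complete_field"
  assumes "\<And>i. i \<in> A \<Longrightarrow> vabs (f i) \<le> C" and "0 \<le> C"
  shows "vabs (sum f A) \<le> C"
  using assms(1)
proof (induction A rule: infinite_finite_induct)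
  case (insert x A)
  have "vabs (sum f A) \<le> C" using insert by blast
  thus ?case
    using insert vabs_add[of "f x" "sum f A"] by (auto intro: order_trans)
qed (use \<open>0 \<le> C\<close> in auto)

section \<open>Continuity of the field operations\<close>

lemma tendsto_iff_vabs:
  fixes f :: "'b \<Rightarrow> 'a::nonarch_complete_field"
  shows "(f \<longlongrightarrow> l) F \<longleftrightarrow> ((\<lambda>x. vabs (f x - l)) \<longlongrightarrow> 0) F"
  by (subst tendsto_dist_iff) (simp add: dist_vabs)

lemma tendsto_vabs:
  fixes f :: "'b \<Rightarrow> 'a::nonarch_complete_field"
  assumes "(f \<longlongrightarrow> l) F"
  shows "((\<lambda>x. vabs (f x)) \<longlongrightarrow> vabs l) F"
  using tendsto_dist[OF assms tendsto_const[of 0]] by (simp add: dist_vabs)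

text \<open>The ultrametric inequality bounds the error of a sum by the larger of the two errors.
  The instance makes the generic limit rules for sums and differences available.\<close>

instance nonarch_complete_field \<subseteq> topological_ab_group_add
proof
  fix a b :: 'a
  have A: "((\<lambda>x. fst x) \<longlongrightarrow> a) (nhds a \<times>\<^sub>F nhds b)" "((\<lambda>x. snd x) \<longlongrightarrow> b) (nhds a \<times>\<^sub>F nhds b)"
    by (auto intro: filterlim_fst filterlim_snd)
  have B: "((\<lambda>x. max (vabs (fst x - a)) (vabs (snd x - b))) \<longlongrightarrow> max 0 0) (nhds a \<times>\<^sub>F nhds b)"
    using A by (intro tendsto_max) (auto simp: tendsto_iff_vabs)
  show "((\<lambda>x. fst x + snd x) \<longlongrightarrow> a + b) (nhds a \<times>\<^sub>F nhds b)"
    unfolding tendsto_iff_vabs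
  proof (rule tendsto_sandwich[OF _ _ tendsto_const B[simplified]]; intro always_eventually allI)
    fix x :: "'a \<times> 'a"
    show "vabs (fst x + snd x - (a + b)) \<le> max (vabs (fst x - a)) (vabs (snd x - b))"
      using vabs_add[of "fst x - a" "snd x - b"] by (simp add: algebra_simps)
  qed auto
  have "((\<lambda>x. x) \<longlongrightarrow> a) (nhds a)" by (rule filterlim_ident)
  moreover have "vabs (- x - (- a)) = vabs (x - a)" for x
    using vabs_minus[of "x - a"] by simp
  ultimately show "(uminus \<longlongrightarrow> - a) (nhds a)"
    by (simp add: tendsto_iff_vabs)
qed

text \<open>Splitting \<open>x * y - a * b\<close> as \<open>x * (y - b) + (x - a) * b\<close>
  leaves two terms that both tend to 0.\<close>

instance nonarch_complete_field \<subseteq> topological_semigroup_mult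
proof
  fix a b :: 'a
  let ?F = "nhds a \<times>\<^sub>F nhds b"
  have A: "((\<lambda>x. fst x) \<longlongrightarrow> a) ?F" "((\<lambda>x. snd x) \<longlongrightarrow> b) ?F"
    by (auto intro: filterlim_fst filterlim_snd)
  have "((\<lambda>x. vabs (fst x) * vabs (snd x - b)) \<longlongrightarrow> vabs a * 0) ?F"
       "((\<lambda>x. vabs (fst x - a) * vabs b) \<longlongrightarrow> 0 * vabs b) ?F"
    using A by (intro tendsto_mult tendsto_vabs tendsto_const; simp add: tendsto_iff_vabs)+
  hence "((\<lambda>x. max (vabs (fst x) * vabs (snd x - b)) (vabs (fst x - a) * vabs b)) \<longlongrightarrow> max (vabs a * 0) (0 * vabs b)) ?F"
    by (rule tendsto_max)
  hence B: "((\<lambda>x. max (vabs (fst x) * vabs (snd x - b)) (vabs (fst x - a) * vabs b)) \<longlongrightarrow> 0) ?F"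
    by simp
  show "((\<lambda>x. fst x * snd x) \<longlongrightarrow> a * b) ?F"
    unfolding tendsto_iff_vabs
  proof (rule tendsto_sandwich[OF _ _ tendsto_const B]; intro always_eventually allI)
    fix x :: "'a \<times> 'a"
    show "vabs (fst x * snd x - a * b) \<le> max (vabs (fst x) * vabs (snd x - b)) (vabs (fst x - a) * vabs b)"
      using vabs_add[of "fst x * (snd x - b)" "(fst x - a) * b"]
      by (simp add: algebra_simps flip: vabs_mult)
  qed auto
qed

section \<open>Convergent series and interchange of limits\<close>

lemma nonarch_sums_mult:
  fixes c :: "'a::nonarch_complete_field"
  assumes "f sums s"
  shows "(\<lambda>n. c * f n) sums (c * s)"
  using tendsto_mult[OF tendsto_const assms[unfolded sums_def], of c]
  by (simp add: sums_def sum_distrib_left)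

lemma nonarch_sums_diff:
  fixes f :: "nat \<Rightarrow> 'a::nonarch_complete_field"
  assumes "f sums s" "g sums t"
  shows "(\<lambda>n. f n - g n) sums (s - t)"
  using tendsto_diff[OF assms[unfolded sums_def]] by (simp add: sums_def sum_subtractf)

lemma nonarch_sums_Suc:
  fixes f :: "nat \<Rightarrow> 'a::nonarch_complete_field"
  assumes "f sums s"
  shows "(\<lambda>n. f (Suc n)) sums (s - f 0)"
  using tendsto_diff[OF LIMSEQ_Suc[OF assms[unfolded sums_def]] tendsto_const[of "f 0"]]
  by (simp add: sums_def sum.lessThan_Suc_shift del: sum.lessThan_Suc)

text \<open>The ultrametric inequality bounds a block of consecutive terms by its largest term, so
  the partial sums are Cauchy as soon as the terms tend to 0.\<close>

lemma nonarch_summable: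
  fixes f :: "nat \<Rightarrow> 'a::nonarch_complete_field"
  assumes "(\<lambda>n. vabs (f n)) \<longlonglongrightarrow> 0"
  shows "summable f"
proof -
  have "Cauchy (\<lambda>n. \<Sum>i<n. f i)"
  proof (rule CauchyI')
    fix e :: real assume e: "e > 0"
    obtain K where K: "\<And>n. n \<ge> K \<Longrightarrow> vabs (f n) < e / 2"
      using order_tendstoD(2)[OF assms, of "e / 2"] e by (auto simp: eventually_sequentially)
    show "\<exists>M. \<forall>m\<ge>M. \<forall>n>m. dist (\<Sum>i<m. f i) (\<Sum>i<n. f i) < e"
    proof (intro exI[of _ K] allI impI)
      fix m n assume mn: "m \<ge> K" "n > m"
      have "(\<Sum>i<n. f i) - (\<Sum>i<m. f i) = (\<Sum>i=m..<n. f i)"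
        using mn sum_diff_nat_ivl[of 0 m n f] by (simp add: atLeast0LessThan)
      hence "dist (\<Sum>i<m. f i) (\<Sum>i<n. f i) = vabs (\<Sum>i=m..<n. f i)"
        by (subst dist_commute) (simp add: dist_vabs)
      moreover have "vabs (\<Sum>i=m..<n. f i) \<le> e / 2"
        by (rule vabs_sum_le) (use mn K e in \<open>auto intro: less_imp_le\<close>)
      ultimately show "dist (\<Sum>i<m. f i) (\<Sum>i<n. f i) < e"
        using e by simp
    qed
  qed
  thus ?thesis
    by (simp add: Cauchy_convergent summable_iff_convergent)
qed

lemma vabs_sums_le:
  fixes f :: "nat \<Rightarrow> 'a::nonarch_complete_field"
  assumes "f sums s" "\<And>n. vabs (f n) \<le> C"
  shows "vabs s \<le> C"
proof (rule tendsto_upperbound)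
  show "(\<lambda>n. vabs (\<Sum>i<n. f i)) \<longlonglongrightarrow> vabs s"
    using assms(1) by (intro tendsto_vabs) (simp add: sums_def)
  have "0 \<le> C" using assms(2)[of 0] vabs_nonneg order_trans by blast
  thus "\<forall>\<^sub>F n in sequentially. vabs (\<Sum>i<n. f i) \<le> C"
    by (intro always_eventually allI vabs_sum_le assms)
qed auto

text \<open>A non-Archimedean form of dominated convergence: the majorant \<open>g\<close> has to
  tend to 0 rather than be summable, because a tail is as small as its largest term.\<close>

lemma nonarch_tannery:
  fixes F :: "nat \<Rightarrow> nat \<Rightarrow> 'a::nonarch_complete_field"
  assumes sums: "\<And>N. F N sums S N"
    and bound: "\<And>N n. vabs (F N n) \<le> g n"
    and g: "g \<longlonglongrightarrow> 0"
    and lim: "\<And>n. (\<lambda>N. F N n) \<longlonglongrightarrow> E n"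
  shows "summable E" and "S \<longlonglongrightarrow> suminf E"
proof -
  have E: "vabs (E n) \<le> g n" for n
    by (rule tendsto_upperbound[OF tendsto_vabs[OF lim]])
       (auto intro!: always_eventually bound)
  show sE: "summable E"
    by (rule nonarch_summable, rule tendsto_sandwich[OF _ _ tendsto_const g])
       (auto intro!: always_eventually E)
  show "S \<longlonglongrightarrow> suminf E"
  proof (rule tendstoI)
    fix e :: real assume e: "e > 0"
    obtain K where K: "\<And>n. n \<ge> K \<Longrightarrow> g n < e / 2"
      using order_tendstoD(2)[OF g, of "e / 2"] e by (auto simp: eventually_sequentially)
    have "\<forall>\<^sub>F N in sequentially. \<forall>n\<in>{..<K}. dist (F N n) (E n) < e / 2"
      using e by (intro eventually_ball_finite ballI tendstoD[OF lim]) auto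
    thus "\<forall>\<^sub>F N in sequentially. dist (S N) (suminf E) < e"
    proof eventually_elim
      case (elim N)
      have "vabs (S N - suminf E) \<le> e / 2"
      proof (rule vabs_sums_le[OF nonarch_sums_diff[OF sums summable_sums[OF sE]]])
        fix n
        show "vabs (F N n - E n) \<le> e / 2"
        \<comment> \<open>Below \<open>K\<close> the finitely many termwise limits are already
          close; from \<open>K\<close> on both terms are below \<open>e / 2\<close>, hence so is
          their difference.\<close>
        proof (cases "n < K")
          case True
          thus ?thesis using elim by (auto simp: dist_vabs intro: less_imp_le)
        next
          case False
          thus ?thesis
            using K[of n] bound[of N n] E[of n] vabs_diff[of "F N n" "E n"] by auto
        qed
      qed
      thus ?case using e by (simp add: dist_vabs)
    qed
  qed
qed

text \<open>Interchange of summation for a double series supported on \<open>m \<le> n\<close>. The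
  sums over the first \<open>M\<close> rows have columns that become constant once
  \<open>M > n\<close>, so \<open>nonarch_tannery\<close> applies with \<open>M\<close> as the limit
  variable.\<close>

lemma nonarch_sums_triangle:
  fixes f :: "nat \<Rightarrow> nat \<Rightarrow> 'a::nonarch_complete_field"
  assumes zero: "\<And>m n. n < m \<Longrightarrow> f m n = 0"
    and bound: "\<And>m n. vabs (f m n) \<le> g n"
    and g: "g \<longlonglongrightarrow> 0"
    and rows: "\<And>m. f m sums R m"
  shows "R sums (\<Sum>n. \<Sum>m\<le>n. f m n)" and "summable (\<lambda>n. \<Sum>m\<le>n. f m n)"
proof -
  let ?F = "\<lambda>M n. \<Sum>m<M. f m n"
  have 1: "?F M sums (\<Sum>m<M. R m)" for M
    by (rule sums_sum) (rule rows)
  have "0 \<le> g n" for n using bound[of 0 n] vabs_nonneg order_trans by blast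
  hence 2: "vabs (?F M n) \<le> g n" for M n
    by (intro vabs_sum_le bound)
  have 3: "(\<lambda>M. ?F M n) \<longlonglongrightarrow> (\<Sum>m\<le>n. f m n)" for n
  proof (rule tendsto_eventually)
    show "\<forall>\<^sub>F M in sequentially. ?F M n = (\<Sum>m\<le>n. f m n)"
      using eventually_gt_at_top[of n]
    proof eventually_elim
      case (elim M)
      show ?case by (rule sum.mono_neutral_right) (use elim zero in auto)
    qed
  qed
  show "summable (\<lambda>n. \<Sum>m\<le>n. f m n)"
    by (rule nonarch_tannery(1)[OF 1 2 g 3])
  show "R sums (\<Sum>n. \<Sum>m\<le>n. f m n)"
    unfolding sums_def by (rule nonarch_tannery(2)[OF 1 2 g 3])
qed

section \<open>Evaluation of formal power series\<close>

text \<open>A quantitative form of convergence at \<open>b\<close> when \<open>q < 1\<close>.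
  Products and powers keep the ratio \<open>q\<close>, and only the constants \<open>C\<close>
  multiply.\<close>

definition fps_geom_bounded :: "real \<Rightarrow> real \<Rightarrow> 'a::nonarch_complete_field \<Rightarrow> 'a fps \<Rightarrow> bool" where
  "fps_geom_bounded C q b F \<longleftrightarrow> (\<forall>n. vabs (fps_nth F n * b ^ n) \<le> C * q ^ n)"

lemma fps_geom_bounded_sums:
  fixes F :: "'a::nonarch_complete_field fps"
  assumes "fps_geom_bounded C q b F" "0 \<le> q" "q < 1"
  shows "(\<lambda>n. fps_nth F n * b ^ n) sums (\<Sum>n. fps_nth F n * b ^ n)"
proof (rule summable_sums, rule nonarch_summable, rule tendsto_sandwich[OF _ _ tendsto_const])
  show "(\<lambda>n. C * q ^ n) \<longlonglongrightarrow> 0"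
    using assms by (intro tendsto_mult_right_zero LIMSEQ_power_zero) auto
qed (use assms in \<open>auto simp: fps_geom_bounded_def\<close>)

lemma fps_geom_bounded_term:
  fixes F G :: "'a::nonarch_complete_field fps"
  assumes "fps_geom_bounded C q b F" "fps_geom_bounded D q b G" "0 \<le> q" "m \<le> n"
  shows "vabs (fps_nth F m * b ^ m * (fps_nth G (n - m) * b ^ (n - m))) \<le> C * D * q ^ n"
proof -
  have "vabs (fps_nth F m * b ^ m) * vabs (fps_nth G (n - m) * b ^ (n - m))
      \<le> (C * q ^ m) * (D * q ^ (n - m))"
    using assms by (intro mult_mono) (auto simp: fps_geom_bounded_def intro: order_trans[OF vabs_nonneg])
  also have "\<dots> = C * D * (q ^ m * q ^ (n - m))" by simp
  also have "q ^ m * q ^ (n - m) = q ^ n" using assms by (simp flip: power_add)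
  finally show ?thesis by (simp add: vabs_mult)
qed

lemma fps_mult_nth_eval:
  fixes F G :: "'a::field fps"
  shows "fps_nth (F * G) n * b ^ n =
    (\<Sum>m\<le>n. fps_nth F m * b ^ m * (fps_nth G (n - m) * b ^ (n - m)))"
  unfolding fps_mult_nth sum_distrib_right atLeast0AtMost
proof (rule sum.cong)
  fix m assume "m \<in> {..n}"
  hence "b ^ n = b ^ m * b ^ (n - m)" by (simp flip: power_add)
  thus "fps_nth F m * fps_nth G (n - m) * b ^ n
      = fps_nth F m * b ^ m * (fps_nth G (n - m) * b ^ (n - m))"
    by simp
qed simp

lemma fps_geom_bounded_nonneg:
  fixes F :: "'a::nonarch_complete_field fps"
  assumes "fps_geom_bounded C q b F"
  shows "0 \<le> C"
  using assms[unfolded fps_geom_bounded_def, rule_format, of 0] vabs_nonneg[of "fps_nth F 0 * b ^ 0"]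
  by (simp del: vabs_nonneg)

lemma fps_geom_bounded_mult:
  fixes F G :: "'a::nonarch_complete_field fps"
  assumes "fps_geom_bounded C q b F" "fps_geom_bounded D q b G" "0 \<le> q"
  shows "fps_geom_bounded (C * D) q b (F * G)"
  unfolding fps_geom_bounded_def
proof
  fix n
  have "0 \<le> C" "0 \<le> D" using assms fps_geom_bounded_nonneg by blast+
  thus "vabs (fps_nth (F * G) n * b ^ n) \<le> C * D * q ^ n"
    unfolding fps_mult_nth_eval using assms
    by (intro vabs_sum_le fps_geom_bounded_term) auto
qed

text \<open>The Cauchy product is a triangular double series: row \<open>m\<close> is the series of
  \<open>G\<close> shifted by \<open>m\<close> places and scaled by the \<open>m\<close>-th term of
  \<open>F\<close>, and the column sums are the terms of \<open>F * G\<close>.\<close>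

lemma fps_eval_mult:
  fixes F G :: "'a::nonarch_complete_field fps"
  assumes F: "fps_geom_bounded C q b F" and G: "fps_geom_bounded D q b G" and q: "0 \<le> q" "q < 1"
  shows "(\<Sum>n. fps_nth (F * G) n * b ^ n) = (\<Sum>n. fps_nth F n * b ^ n) * (\<Sum>n. fps_nth G n * b ^ n)"
proof -
  define f where "f m n = (if m \<le> n then fps_nth F m * b ^ m * (fps_nth G (n - m) * b ^ (n - m)) else 0)" for m n
  let ?G = "\<Sum>n. fps_nth G n * b ^ n"
  have CD: "0 \<le> C * D" using F G fps_geom_bounded_nonneg by (metis mult_nonneg_nonneg)
  have g: "(\<lambda>n. C * D * q ^ n) \<longlonglongrightarrow> 0"
    using q by (intro tendsto_mult_right_zero LIMSEQ_power_zero) auto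
  have rows: "f m sums (fps_nth F m * b ^ m * ?G)" for m
  proof -
    have "(\<lambda>n. f m (n + m)) sums (fps_nth F m * b ^ m * ?G)"
      unfolding f_def using nonarch_sums_mult[OF fps_geom_bounded_sums[OF G q]] by simp
    hence "(\<lambda>k. \<Sum>n<k. f m (n + m)) \<longlonglongrightarrow> fps_nth F m * b ^ m * ?G" by (simp add: sums_def)
    moreover have "(\<Sum>n<k. f m (n + m)) = (\<Sum>n<k + m. f m n)" for k
    proof -
      have "(\<Sum>n<k + m. f m n) = (\<Sum>n=m..<k + m. f m n)"
        by (rule sum.mono_neutral_right) (auto simp: f_def)
      also have "\<dots> = (\<Sum>n<k. f m (n + m))"
        using sum.shift_bounds_nat_ivl[of "f m" 0 m k] by (simp add: atLeast0LessThan)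
      finally show ?thesis by simp
    qed
    ultimately have "(\<lambda>k. \<Sum>n<k + m. f m n) \<longlonglongrightarrow> fps_nth F m * b ^ m * ?G" by simp
    thus ?thesis unfolding sums_def by (rule LIMSEQ_offset)
  qed
  have "vabs (f m n) \<le> C * D * q ^ n" for m n
    using fps_geom_bounded_term[OF F G] q CD by (auto simp: f_def)
  from nonarch_sums_triangle(1)[of f, OF _ this g rows]
  have "(\<lambda>m. fps_nth F m * b ^ m * ?G) sums (\<Sum>n. \<Sum>m\<le>n. f m n)"
    by (simp add: f_def)
  moreover have "(\<lambda>m. fps_nth F m * b ^ m * ?G) sums ((\<Sum>n. fps_nth F n * b ^ n) * ?G)"
    using nonarch_sums_mult[OF fps_geom_bounded_sums[OF F q], of ?G] by (simp add: mult.commute)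
  ultimately show ?thesis
    by (simp add: f_def fps_mult_nth_eval sums_unique2)
qed

lemma fps_geom_bounded_power:
  fixes F :: "'a::nonarch_complete_field fps"
  assumes F: "fps_geom_bounded C q b F" and q: "0 \<le> q" "q < 1"
  shows "fps_geom_bounded (C ^ m) q b (F ^ m)"
    and "(\<Sum>n. fps_nth (F ^ m) n * b ^ n) = (\<Sum>n. fps_nth F n * b ^ n) ^ m"
proof (induction m)
  case 0
  have *: "fps_nth (1::'a fps) n * b ^ n = (if n = 0 then 1 else 0)" for n by simp
  {
    case 1
    show ?case using q by (simp add: fps_geom_bounded_def *)
  next
    case 2
    show ?case using sums_single[of 0 "\<lambda>_. 1::'a"] by (simp only: * sums_iff power_0)
  }
next
  case (Suc m)
  {
    case 1
    show ?case using fps_geom_bounded_mult[OF F Suc(1)] q by simp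
  next
    case 2
    show ?case using fps_eval_mult[OF F Suc(1)] Suc(2) q by simp
  }
qed

text \<open>\<open>fps_binomial c\<close> is the only series \<open>F\<close> with
  \<open>F' = c F / (1 + X)\<close> and constant term 1; the chain rule gives this equation for the
  composition.\<close>

lemma fps_exp_compose_ln:
  "fps_exp c oo fps_ln 1 = fps_binomial (c::'a::field_char_0)"
  unfolding fps_binomial_ODE_unique'[symmetric]
  by (simp add: fps_compose_deriv fps_ln_deriv fps_compose_mult_distrib fps_divide_unit)


section \<open>The p-adic exponential and logarithm\<close>

text \<open>\<open>r\<close> is the radius of the disc \<open>padic_E p\<close>, and
  \<open>T\<close> fixes the type in which the absolute value is taken.\<close>

locale padic_valued =
  fixes p :: nat and r :: real and T :: "'a::nonarch_complete_field itself"
  assumes prime_p: "prime p"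
    and vabs_p: "vabs (of_nat p :: 'a) = 1 / real p"
    and r_eq: "r = real p powr (- 1 / (real p - 1))"
begin

section \<open>Absolute values of integers and factorials\<close>

lemma p_gt_1: "p > 1"
  using prime_p prime_gt_1_nat by blast

lemma r_pos: "0 < r"
  using p_gt_1 by (simp add: r_eq)

lemma r_less_1: "r < 1"
  using p_gt_1 unfolding r_eq by (intro powr_less_one) auto

lemma r_power: "r ^ (p - 1) = 1 / real p"
proof -
  have "r ^ (p - 1) = real p powr (- 1 / (real p - 1) * real (p - 1))"
    using p_gt_1 by (simp add: r_eq powr_powr flip: powr_realpow)
  also have "- 1 / (real p - 1) * real (p - 1) = - 1"
    using p_gt_1 by (simp add: of_nat_diff field_simps)
  finally show ?thesis using p_gt_1 by (simp add: powr_minus_divide)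
qed

text \<open>By Bezout \<open>u p + v k = 1\<close>. The first summand has absolute value below 1, so
  the second must reach 1, and integers have absolute value at most 1.\<close>

lemma vabs_of_nat_not_dvd:
  assumes "\<not> p dvd k"
  shows "vabs (of_nat k :: 'a) = 1"
proof -
  have int_le: "vabs (of_int i :: 'a) \<le> 1" for i
    by (cases i rule: int_cases2) (auto simp: vabs_of_nat_le_1)
  have "coprime (int p) (int k)"
    using assms prime_p prime_imp_coprime by auto
  then obtain u v where "u * int p + v * int k = 1"
    using bezout_int[of "int p" "int k"] by auto
  hence "(of_int (u * int p + v * int k) :: 'a) = 1" by simp
  hence "1 \<le> max (vabs (of_int u * of_nat p :: 'a)) (vabs (of_int v * of_nat k :: 'a))"
    using vabs_add[of "of_int u * of_nat p :: 'a" "of_int v * of_nat k"] by simp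
  moreover have "vabs (of_int u * of_nat p :: 'a) < 1"
  proof -
    have "vabs (of_int u * of_nat p :: 'a) \<le> 1 * (1 / real p)"
      unfolding vabs_mult vabs_p by (intro mult_right_mono int_le) auto
    also have "\<dots> < 1" using p_gt_1 by simp
    finally show ?thesis .
  qed
  ultimately have "1 \<le> vabs (of_int v :: 'a) * vabs (of_nat k :: 'a)"
    by (simp add: vabs_mult)
  also have "\<dots> \<le> 1 * vabs (of_nat k :: 'a)"
    by (intro mult_right_mono int_le) auto
  finally show ?thesis using vabs_of_nat_le_1[of k, where 'a='a] by simp
qed

lemma vabs_two:
  assumes "odd p"
  shows "vabs (2 :: 'a) = 1"
proof -
  have "\<not> p dvd 2"
    using assms primes_dvd_imp_eq[OF prime_p two_is_prime_nat] by auto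
  thus ?thesis using vabs_of_nat_not_dvd[of 2] by simp
qed

text \<open>The factors \<open>p * m + 1\<close> to \<open>p * m + j\<close> are prime to
  \<open>p\<close>, so they do not change the absolute value.\<close>

lemma vabs_fact_block:
  assumes "j < p" and "vabs (fact (p * m) :: 'a) = C"
  shows "vabs (fact (p * m + j) :: 'a) = C"
  using assms(1)
proof (induction j)
  case (Suc j)
  have "\<not> p dvd (p * m + Suc j)"
    using Suc.prems by (metis dvd_add_right_iff dvd_triv_left nat_dvd_not_less zero_less_Suc)
  hence "vabs (of_nat (Suc (p * m + j)) :: 'a) = 1"
    using vabs_of_nat_not_dvd by (metis add_Suc_right)
  thus ?case using Suc by (simp add: vabs_mult del: of_nat_Suc)
qed (use assms in auto)

text \<open>Legendre's recursion: only the multiples of \<open>p\<close> among the factors count,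
  each contributes \<open>1 / p = r ^ (p - 1)\<close>, and their cofactors form
  \<open>fact m\<close>.\<close>

lemma vabs_fact_mult: "vabs (fact (p * m) :: 'a) = r ^ ((p - 1) * m) * vabs (fact m :: 'a)"
proof (induction m)
  case (Suc m)
  have eq: "p * Suc m = Suc (p * m + (p - 1))" using p_gt_1 by simp
  have "vabs (fact (p * Suc m) :: 'a) = vabs (of_nat (p * Suc m) :: 'a) * vabs (fact (p * m + (p - 1)) :: 'a)"
    unfolding eq fact_Suc by (simp add: vabs_mult del: of_nat_Suc)
  also have "\<dots> = r ^ (p - 1) * vabs (of_nat (Suc m) :: 'a) * (r ^ ((p - 1) * m) * vabs (fact m :: 'a))"
    using vabs_fact_block[OF diff_less[OF zero_less_one prime_gt_0_nat[OF prime_p]] Suc]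
    by (simp only: of_nat_mult vabs_mult vabs_p r_power)
  also have "\<dots> = r ^ ((p - 1) * Suc m) * vabs (fact (Suc m) :: 'a)"
    by (simp add: vabs_mult power_add del: of_nat_Suc)
  finally show ?case .
qed simp

text \<open>The estimate \<open>v\<^sub>p(n!) \<le> (n - 1) / (p - 1)\<close>, in multiplicative form.\<close>

lemma vabs_fact_ge: "n > 0 \<Longrightarrow> r ^ (n - 1) \<le> vabs (fact n :: 'a)"
proof (induction n rule: less_induct)
  case (less n)
  define m where "m = n div p"
  have n: "n = p * m + n mod p" by (simp add: m_def)
  have fact_n: "vabs (fact n :: 'a) = r ^ ((p - 1) * m) * vabs (fact m :: 'a)"
    using vabs_fact_block[OF _ vabs_fact_mult, of "n mod p" m] p_gt_1 n by simp
  show ?case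
  proof (cases "m = 0")
    case True
    thus ?thesis using fact_n r_pos r_less_1 by (simp add: power_le_one)
  next
    case False
    have "m < n" using False p_gt_1 less.prems by (simp add: m_def)
    \<comment> \<open>The exponent on the right is \<open>p * m - 1\<close>, which is at most
      \<open>n - 1\<close>, and \<open>r < 1\<close> reverses the order.\<close>
    have "r ^ (n - 1) \<le> r ^ ((p - 1) * m + (m - 1))"
    proof (rule power_decreasing)
      have "(p - 1) * m + m = p * m" using p_gt_1 by (simp add: diff_mult_distrib)
      thus "(p - 1) * m + (m - 1) \<le> n - 1" using False n by linarith
    qed (use r_pos r_less_1 in auto)
    also have "\<dots> \<le> r ^ ((p - 1) * m) * vabs (fact m :: 'a)"
      unfolding power_add using less.IH[OF \<open>m < n\<close>] False r_pos by (intro mult_left_mono) auto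
    finally show ?thesis using fact_n by simp
  qed
qed

lemma r_power_le_fact: "r ^ n \<le> vabs (fact n :: 'a)"
proof (cases "n = 0")
  case False
  have "r ^ n \<le> r ^ (n - 1)" using r_pos r_less_1 by (intro power_decreasing) auto
  also have "\<dots> \<le> vabs (fact n :: 'a)" using False by (intro vabs_fact_ge) simp
  finally show ?thesis .
qed simp

text \<open>Dividing \<open>fact n\<close> by the integer \<open>fact (n - 1)\<close> turns the
  factorial estimate into one for \<open>n\<close> itself; it controls the denominators of the
  logarithm.\<close>

lemma r_power_le_of_nat:
  assumes "n > 0"
  shows "r ^ n \<le> r * vabs (of_nat n :: 'a)"
proof -
  obtain k where k: "n = Suc k" using assms by (cases n) auto
  have fact_le: "vabs (fact k :: 'a) \<le> 1"
    using vabs_of_nat_le_1[of "fact k", where 'a='a] by simp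
  have "r ^ n = r * r ^ (n - 1)" by (simp add: k)
  also have "\<dots> \<le> r * vabs (fact n :: 'a)"
    using assms r_pos by (intro mult_left_mono vabs_fact_ge) auto
  also have "vabs (fact n :: 'a) = vabs (of_nat n :: 'a) * vabs (fact k :: 'a)"
    by (simp add: k vabs_mult del: of_nat_Suc)
  also have "r * \<dots> \<le> r * (vabs (of_nat n :: 'a) * 1)"
    using fact_le r_pos by (intro mult_left_mono) auto
  finally show ?thesis by simp
qed

section \<open>The exponential series\<close>

lemma vabs_exp_term:
  assumes "vabs z \<le> q * r"
  shows "vabs (z ^ n / fact n :: 'a) \<le> q ^ n"
proof -
  have q: "0 \<le> q"
    using order_trans[OF vabs_nonneg assms] r_pos by (simp add: zero_le_mult_iff)
  have "vabs z ^ n \<le> (q * r) ^ n" using assms by (intro power_mono) auto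
  also have "\<dots> \<le> q ^ n * vabs (fact n :: 'a)"
    using q r_power_le_fact[of n] by (auto simp: power_mult_distrib intro: mult_left_mono)
  finally show ?thesis by (simp add: vabs_divide vabs_power pos_divide_le_eq)
qed

lemma fps_exp_bounded:
  assumes "vabs (z :: 'a) \<le> q * r"
  shows "fps_geom_bounded 1 q 1 (fps_exp z)"
  using vabs_exp_term[OF assms] by (simp add: fps_geom_bounded_def)

text \<open>The argument \<open>z\<close> sits in the coefficients and the evaluation point is 1, so
  that exponentials of different arguments are evaluated at the same point and can be multiplied by
  \<open>fps_eval_mult\<close>.\<close>

lemma padic_exp_eval: "padic_exp z = (\<Sum>n. fps_nth (fps_exp (z :: 'a)) n * 1 ^ n)"
  by (simp add: padic_exp_def)

lemma padic_exp_sums: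
  assumes "vabs (z :: 'a) < r"
  shows "(\<lambda>n. z ^ n / fact n) sums padic_exp z"
  using fps_geom_bounded_sums[OF fps_exp_bounded[of z "vabs z / r"]] assms r_pos
  by (simp add: padic_exp_def)

lemma padic_exp_add:
  assumes "vabs (x :: 'a) < r" "vabs y < r"
  shows "padic_exp (x + y) = padic_exp x * padic_exp y"
proof -
  \<comment> \<open>One ratio must serve both factors of the product.\<close>
  define q where "q = max (vabs x) (vabs y) / r"
  have "vabs x \<le> q * r" "vabs y \<le> q * r" "0 \<le> q" "q < 1"
    using assms r_pos by (auto simp: q_def le_max_iff_disj)
  thus ?thesis
    unfolding padic_exp_eval fps_exp_add_mult by (metis fps_eval_mult fps_exp_bounded)
qed

lemma padic_exp_0: "padic_exp (0 :: 'a) = 1"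
  using sums_single[of 0 "\<lambda>_. 1::'a"] 
  by (simp add: padic_exp_def power_0_left sums_iff if_distrib[of "\<lambda>x. x / _"] cong: if_cong)

lemma padic_exp_of_nat_mult:
  assumes "vabs (z :: 'a) < r"
  shows "padic_exp (of_nat k * z) = padic_exp z ^ k"
proof (induction k)
  case (Suc k)
  have "vabs (of_nat k * z) \<le> 1 * vabs z"
    unfolding vabs_mult by (intro mult_right_mono vabs_of_nat_le_1) auto
  thus ?case using padic_exp_add[of z "of_nat k * z"] assms Suc by (simp add: algebra_simps)
qed (simp add: padic_exp_0)

text \<open>Every term after the constant one is at most a positive power of
  \<open>vabs z / r < 1\<close>. The bound shows both that the exponential stays away from -1 and
  that it tends to 1 as \<open>z\<close> tends to 0.\<close>

lemma vabs_padic_exp_minus_1: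
  assumes "vabs (z :: 'a) < r"
  shows "vabs (padic_exp z - 1) \<le> vabs z / r"
proof -
  let ?q = "vabs z / r"
  have "(\<lambda>n. z ^ Suc n / fact (Suc n)) sums (padic_exp z - 1)"
    using nonarch_sums_Suc[OF padic_exp_sums[OF assms]] by simp
  moreover have "vabs (z ^ Suc n / fact (Suc n)) \<le> ?q" for n
  proof -
    have "vabs (z ^ Suc n / fact (Suc n)) \<le> ?q ^ Suc n"
      using r_pos by (intro vabs_exp_term) simp
    also have "\<dots> \<le> ?q ^ 1" using assms r_pos by (intro power_decreasing) auto
    finally show ?thesis by simp
  qed
  ultimately show ?thesis by (rule vabs_sums_le)
qed

section \<open>The logarithm and the binomial series\<close>

lemma fps_ln_bounded:
  fixes b :: 'a
  shows "fps_geom_bounded r (vabs b / r) b (fps_ln 1)"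
  unfolding fps_geom_bounded_def
proof
  fix n
  show "vabs (fps_nth (fps_ln 1) n * b ^ n) \<le> r * (vabs b / r) ^ n"
  proof (cases "n = 0")
    case False
    have pos: "0 < vabs (of_nat n :: 'a)" using False by simp
    have "vabs (fps_nth (fps_ln 1) n * b ^ n) = vabs b ^ n / vabs (of_nat n :: 'a)"
      using False by (simp add: fps_ln_nth vabs_mult vabs_divide vabs_power)
    \<comment> \<open>The factor \<open>r\<close> is kept as the constant of the bound: in the
      \<open>m\<close>-th power of the series it becomes \<open>r ^ m\<close>, which later cancels
      the growth of \<open>y ^ m / fact m\<close>.\<close>
    also have "\<dots> \<le> vabs b ^ n * (r / r ^ n)"
    proof -
      have "1 / vabs (of_nat n :: 'a) \<le> r / r ^ n"
        using r_power_le_of_nat[of n] False pos zero_less_power[OF r_pos, of n]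
        by (simp add: field_simps)
      from mult_left_mono[OF this, of "vabs b ^ n"] show ?thesis by simp
    qed
    finally show ?thesis by (simp add: power_divide mult.commute)
  qed (use r_pos in simp)
qed

lemma padic_log_eval:
  fixes b :: 'a
  assumes "vabs b < r"
  shows "padic_log (1 + b) = (\<Sum>n. fps_nth (fps_ln 1) n * b ^ n)"
    and "vabs (padic_log (1 + b)) \<le> vabs b"
proof -
  let ?L = "\<Sum>n. fps_nth (fps_ln 1) n * b ^ n"
  have sums: "(\<lambda>n. fps_nth (fps_ln 1) n * b ^ n) sums ?L"
    using assms r_pos by (intro fps_geom_bounded_sums[OF fps_ln_bounded]) auto
  \<comment> \<open>The constant coefficient of \<open>fps_ln 1\<close> is 0, so the index shift to
    the form in \<open>padic_log\<close> leaves the sum unchanged.\<close>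
  have "(\<lambda>n. (- 1) ^ n * b ^ Suc n / of_nat (Suc n)) sums ?L"
    using nonarch_sums_Suc[OF sums] by (simp add: fps_ln_nth)
  thus eq: "padic_log (1 + b) = ?L"
    by (simp add: padic_log_def sums_iff)
  have "vabs (fps_nth (fps_ln 1) n * b ^ n) \<le> vabs b" for n
  proof (cases "n = 0")
    case False
    have "vabs (fps_nth (fps_ln 1) n * b ^ n) \<le> r * (vabs b / r) ^ n"
      using fps_ln_bounded[of b] by (simp add: fps_geom_bounded_def)
    also have "(vabs b / r) ^ n \<le> (vabs b / r) ^ 1"
      using assms r_pos False by (intro power_decreasing) auto
    finally show ?thesis using r_pos by simp
  qed simp
  from vabs_sums_le[OF sums this] show "vabs (padic_log (1 + b)) \<le> vabs b"
    by (simp add: eq)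
qed

text \<open>Expanding each power of the logarithm in the exponential series gives a double series in
  \<open>m\<close> and \<open>n\<close>. Summed by rows it is the exponential; summed by columns it
  is the composed formal series, which is the binomial series by
  \<open>fps_exp_compose_ln\<close>.\<close>

lemma binomial_series_sums:
  fixes b y :: 'a
  assumes b: "vabs b < r" and y: "vabs y \<le> 1"
  shows "(\<lambda>n. (y gchoose n) * b ^ n) sums padic_exp (y * padic_log (1 + b))"
proof -
  define q where "q = vabs b / r"
  have q: "0 \<le> q" "q < 1" using b r_pos by (auto simp: q_def)
  have bd: "fps_geom_bounded r q b (fps_ln 1)" unfolding q_def by (rule fps_ln_bounded)
  let ?l = "padic_log (1 + b)"
  define f where "f m n = fps_nth (fps_exp y) m * (fps_nth (fps_ln 1 ^ m) n * b ^ n)" for m n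
  \<comment> \<open>The logarithm series starts in degree 1, so its \<open>m\<close>-th power starts
    in degree at least \<open>m\<close>.\<close>
  have zero: "f m n = 0" if "n < m" for m n
    using startsby_zero_power_prefix[of "fps_ln 1 :: 'a fps" m] that by (simp add: f_def)
  have bound: "vabs (f m n) \<le> q ^ n" for m n
  proof -
    \<comment> \<open>\<open>vabs_exp_term\<close> is used with the ratio \<open>1 / r\<close>,
      which exceeds 1; the resulting \<open>(1 / r) ^ m\<close> cancels against the
      \<open>r ^ m\<close> from the logarithm, leaving a bound uniform in \<open>m\<close>.\<close>
    have "vabs y * r \<le> 1 * r" using y r_pos by (intro mult_right_mono) auto
    hence "vabs (fps_nth (fps_exp y) m) \<le> (1 / r) ^ m"
      using vabs_exp_term[of y "1 / r" m] y r_pos by simp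
    moreover have "vabs (fps_nth (fps_ln 1 ^ m) n * b ^ n) \<le> r ^ m * q ^ n"
      using fps_geom_bounded_power(1)[OF bd q] by (simp add: fps_geom_bounded_def)
    ultimately have "vabs (f m n) \<le> (1 / r) ^ m * (r ^ m * q ^ n)"
      unfolding f_def vabs_mult[of "fps_nth (fps_exp y) m"] using r_pos by (intro mult_mono) auto
    thus ?thesis using r_pos by (simp add: power_divide)
  qed
  have g: "(\<lambda>n. q ^ n) \<longlonglongrightarrow> 0" using q by (intro LIMSEQ_power_zero) auto
  have rows: "f m sums ((y * ?l) ^ m / fact m)" for m
    using nonarch_sums_mult[OF fps_geom_bounded_sums[OF fps_geom_bounded_power(1)[OF bd q] q], of "fps_nth (fps_exp y) m" m]
    by (simp add: f_def[abs_def] fps_geom_bounded_power(2)[OF bd q] padic_log_eval(1)[OF b] power_mult_distrib)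
  have "(\<Sum>m\<le>n. f m n) = (y gchoose n) * b ^ n" for n
    unfolding fps_binomial_nth[symmetric] fps_exp_compose_ln[symmetric]
    by (simp add: fps_compose_nth f_def sum_distrib_right atLeast0AtMost mult.assoc)
  with nonarch_sums_triangle[of f "\<lambda>n. q ^ n", OF zero bound g rows]
  have *: "summable (\<lambda>n. (y gchoose n) * b ^ n)"
      "(\<lambda>m. (y * ?l) ^ m / fact m) sums (\<Sum>n. (y gchoose n) * b ^ n)"
    by simp_all
  have "padic_exp (y * ?l) = (\<Sum>n. (y gchoose n) * b ^ n)"
    using *(2) by (simp add: padic_exp_def sums_iff)
  thus ?thesis using *(1) by (simp add: summable_sums)
qed

section \<open>Fermionic integrals of polynomials\<close>

lemma p_power_tendsto_0: "(\<lambda>N. of_nat (p ^ N) :: 'a) \<longlonglongrightarrow> 0"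
proof -
  have "(\<lambda>N. (1 / real p) ^ N) \<longlonglongrightarrow> 0"
    using p_gt_1 by (intro LIMSEQ_power_zero) auto
  thus ?thesis
    by (subst tendsto_iff_vabs) (simp add: vabs_power vabs_p)
qed

lemma tendsto_poly_nonarch:
  fixes Q :: "'a poly"
  assumes "(f \<longlongrightarrow> l) F"
  shows "((\<lambda>x. poly Q (f x)) \<longlongrightarrow> poly Q l) F"
  by (induction Q) (auto intro!: tendsto_intros assms)

text \<open>The sum telescopes. For \<open>M = p ^ N\<close> it is the finite form of the shift
  equation of the fermionic integral.\<close>

lemma alternating_sum_shift:
  fixes g :: "nat \<Rightarrow> 'a"
  shows "(\<Sum>x<M. (g (Suc x) + g x) * (- 1) ^ x) = g 0 - (- 1) ^ M * g M"
  by (induction M) (auto simp: algebra_simps)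

text \<open>Induction on the degree through the forward difference \<open>D\<close>: the shift
  identity expresses twice the alternating sum of \<open>Q\<close> by the boundary values of
  \<open>Q\<close> and the alternating sum of \<open>D\<close>, which has lower degree.\<close>

lemma fermionic_poly_convergent:
  fixes Q :: "'a poly"
  assumes "odd p"
  shows "convergent (\<lambda>N. \<Sum>x<p ^ N. poly Q (of_nat x) * (- 1) ^ x)"
proof (induction "degree Q" arbitrary: Q rule: less_induct)
  case less
  define D where "D = pcompose Q [:1, 1:] - Q"
  have "degree D \<le> degree Q"
    unfolding D_def by (rule degree_diff_le) (auto simp: degree_pcompose)
  \<comment> \<open>Translation by 1 preserves the leading coefficient. The case
    \<open>D = 0\<close> below covers constant \<open>Q\<close>, where no smaller degree
    exists.\<close>
  moreover have "coeff D (degree Q) = 0"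
    using lead_coeff_comp[of "[:1, 1::'a:]" Q] by (simp add: D_def degree_pcompose)
  ultimately have "D = 0 \<or> degree D < degree Q" by (rule eq_zero_or_degree_less)
  hence "convergent (\<lambda>N. \<Sum>x<p ^ N. poly D (of_nat x) * (- 1) ^ x)"
    using less by (auto simp: convergent_const)
  then obtain L where L: "(\<lambda>N. \<Sum>x<p ^ N. poly D (of_nat x) * (- 1) ^ x) \<longlonglongrightarrow> L"
    by (auto simp: convergent_def)
  have eq: "(\<Sum>x<p ^ N. poly Q (of_nat x) * (- 1) ^ x) =
    (poly Q 0 + poly Q (of_nat (p ^ N)) - (\<Sum>x<p ^ N. poly D (of_nat x) * (- 1) ^ x)) * (1 / 2)" for N
  proof -
    have "(\<Sum>x<p ^ N. poly D (of_nat x) * (- 1) ^ x) + 2 * (\<Sum>x<p ^ N. poly Q (of_nat x) * (- 1) ^ x)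
      = (\<Sum>x<p ^ N. (poly Q (of_nat (Suc x)) + poly Q (of_nat x)) * (- 1) ^ x)"
      by (simp add: D_def poly_pcompose sum_distrib_left algebra_simps flip: sum.distrib)
    also have "\<dots> = poly Q 0 + poly Q (of_nat (p ^ N))"
      using assms by (subst alternating_sum_shift) simp
    finally show ?thesis by (simp add: field_simps)
  qed
  have "(\<lambda>N. poly Q (of_nat (p ^ N))) \<longlonglongrightarrow> poly Q 0"
    by (rule tendsto_poly_nonarch[OF p_power_tendsto_0])
  from tendsto_mult[OF tendsto_diff[OF tendsto_add[OF tendsto_const this] L] tendsto_const]
  show ?case unfolding eq convergent_def by (rule exI)
qed

text \<open>\<open>fermionic_integral\<close> is a \<open>lim\<close>, which carries information
  only if the limit exists; existence follows since the falling factorial is a polynomial in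
  \<open>x\<close>.\<close>

lemma deg_euler_LIMSEQ:
  fixes lam :: 'a
  assumes "odd p"
  shows "(\<lambda>N. \<Sum>x<p ^ N. gen_falling (of_nat x) n lam * (- 1) ^ x) \<longlonglongrightarrow> deg_euler p lam n"
proof -
  define Q where "Q = (\<Prod>i<n. [:- (of_nat i * lam), 1:])"
  have "gen_falling x n lam = poly Q x" for x
    by (simp add: gen_falling_def Q_def poly_prod)
  thus ?thesis
    using fermionic_poly_convergent[OF assms, of Q]
    by (simp add: deg_euler_def fermionic_integral_def convergent_LIMSEQ_iff)
qed

lemma deg_euler_0:
  assumes "odd p"
  shows "deg_euler p (lam :: 'a) 0 = 1"
proof -
  have "(\<Sum>x<M. (- 1) ^ x) = (if odd M then 1 else (0::'a))" for M
    by (induction M) auto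
  hence "(\<lambda>N. \<Sum>x<p ^ N. gen_falling (of_nat x) 0 lam * (- 1) ^ x) = (\<lambda>N. 1)"
    using assms by (simp add: gen_falling_def)
  thus ?thesis using deg_euler_LIMSEQ[OF assms, of 0 lam] by (simp add: LIMSEQ_const_iff)
qed

section \<open>The degenerate exponential\<close>

text \<open>Taking \<open>lam\<close> out of each factor turns the series into the binomial series
  with exponent \<open>x / lam\<close> at the point \<open>lam * a\<close>.\<close>

lemma gen_falling_gbinomial:
  fixes lam a x :: 'a
  assumes "lam \<noteq> 0"
  shows "gen_falling x n lam * a ^ n / fact n = (x / lam gchoose n) * (lam * a) ^ n"
proof -
  have "gen_falling x n lam = (\<Prod>i<n. lam * (x / lam - of_nat i))"
    unfolding gen_falling_def using assms by (intro prod.cong) (auto simp: field_simps)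
  also have "\<dots> = lam ^ n * (\<Prod>i<n. x / lam - of_nat i)"
    by (simp add: prod.distrib)
  finally show ?thesis
    by (simp add: gbinomial_prod_rev atLeast0LessThan power_mult_distrib)
qed

lemma deg_exp_sums:
  fixes lam a x :: 'a
  assumes "lam \<noteq> 0" "vabs x \<le> vabs lam" "vabs (lam * a) < r"
  shows "(\<lambda>n. gen_falling x n lam * a ^ n / fact n) sums deg_exp lam x a"
  unfolding gen_falling_gbinomial[OF assms(1)] deg_exp_def
  using assms by (intro binomial_series_sums) (auto simp: vabs_divide divide_le_eq_1)

text \<open>Since \<open>vabs lam\<close> is at least 1, it dominates both \<open>x\<close> and
  \<open>i * lam\<close> in every factor. The bound does not depend on \<open>x\<close>.\<close>

lemma vabs_gen_falling_le:
  fixes lam :: 'a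
  assumes "vabs lam \<ge> 1"
  shows "vabs (gen_falling (of_nat x) n lam) \<le> vabs lam ^ n"
proof (induction n)
  case (Suc n)
  have "vabs (of_nat x - of_nat n * lam) \<le> max (vabs (of_nat x :: 'a)) (vabs (of_nat n * lam))"
    by (rule vabs_diff)
  also have "\<dots> \<le> vabs lam"
    using assms vabs_of_nat_le_1[of x, where 'a='a] vabs_of_nat_le_1[of n, where 'a='a]
    by (auto simp: vabs_mult intro: mult_left_le_one_le)
  finally have "vabs (gen_falling (of_nat x) n lam) * vabs (of_nat x - of_nat n * lam)
      \<le> vabs lam ^ n * vabs lam"
    using Suc by (intro mult_mono) auto
  thus ?case by (simp add: gen_falling_def vabs_mult mult.commute)
qed (simp add: gen_falling_def)

theorem deg_euler_generating_function:
  fixes lam a :: 'a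
  assumes "odd p" "vabs lam \<ge> 1" "vabs (lam * a) < r"
  shows "(\<lambda>n. deg_euler p lam n * a ^ n / fact n) sums (2 / (deg_exp lam 1 a + 1))"
    and "deg_exp lam 1 a + 1 \<noteq> 0"
proof -
  define z where "z = 1 / lam * padic_log (1 + lam * a)"
  define w where "w = deg_exp lam 1 a"
  define q where "q = vabs (lam * a) / r"
  have lam: "lam \<noteq> 0" using assms(2) by auto
  \<comment> \<open>Division by \<open>lam\<close> does not enlarge, as
    \<open>vabs lam \<ge> 1\<close>, and the logarithm does not enlarge either.\<close>
  have "vabs z \<le> 1 * vabs (lam * a)"
    unfolding z_def vabs_mult[of "1 / lam"] using assms padic_log_eval(2)[OF assms(3)]
    by (intro mult_mono) (auto simp: vabs_divide divide_le_eq_1)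
  hence z: "vabs z < r" using assms by simp
  have w: "w = padic_exp z" by (simp add: w_def z_def deg_exp_def)
  have w_pow: "deg_exp lam (of_nat k) a = w ^ k" for k
    using padic_exp_of_nat_mult[OF z, of k] by (simp add: w deg_exp_def z_def)
  show nz: "deg_exp lam 1 a + 1 \<noteq> 0"
  proof
    assume "deg_exp lam 1 a + 1 = 0"
    hence "w = - 1" by (simp add: w_def eq_neg_iff_add_eq_0)
    \<comment> \<open>Here \<open>w - 1 = - 2\<close>, a unit because \<open>p\<close> is odd,
      whereas \<open>w\<close> lies at distance less than 1 from 1.\<close>
    hence "vabs (w - 1) = 1" using vabs_two[OF assms(1)] vabs_minus[of "2::'a"] by simp
    hence "1 \<le> vabs z / r" using vabs_padic_exp_minus_1[OF z] by (simp add: w)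
    thus False using z r_pos by simp
  qed
  \<comment> \<open>The power is the exponential of \<open>p ^ N * z\<close>, whose argument tends
    to 0.\<close>
  have w_lim: "(\<lambda>N. w ^ (p ^ N)) \<longlonglongrightarrow> 1"
  proof -
    have z_lim: "(\<lambda>N. vabs (of_nat (p ^ N) * z) / r) \<longlonglongrightarrow> 0"
      using tendsto_divide[OF tendsto_vabs[OF tendsto_mult[OF p_power_tendsto_0 tendsto_const[of z]]] tendsto_const[of r]] r_pos
      by simp
    have "vabs (w ^ (p ^ N) - 1) \<le> vabs (of_nat (p ^ N) * z) / r" for N
    proof -
      have "vabs (of_nat (p ^ N) * z) \<le> 1 * vabs z"
        unfolding vabs_mult by (intro mult_right_mono vabs_of_nat_le_1) auto
      hence "vabs (padic_exp (of_nat (p ^ N) * z) - 1) \<le> vabs (of_nat (p ^ N) * z) / r"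
        using z by (intro vabs_padic_exp_minus_1) simp
      thus ?thesis by (simp only: padic_exp_of_nat_mult[OF z] w)
    qed
    thus ?thesis
      unfolding tendsto_iff_vabs
      by (intro tendsto_sandwich[OF _ _ tendsto_const z_lim] always_eventually allI) auto
  qed
  let ?s = "\<lambda>N n. \<Sum>x<p ^ N. gen_falling (of_nat x) n lam * (- 1) ^ x"
  have sums: "(\<lambda>n. ?s N n * (a ^ n / fact n)) sums ((1 + w ^ (p ^ N)) / (w + 1))" for N
  proof -
    have "(\<lambda>n. \<Sum>x<p ^ N. (- 1) ^ x * (gen_falling (of_nat x) n lam * a ^ n / fact n))
      sums (\<Sum>x<p ^ N. (- 1) ^ x * w ^ x)"
      unfolding w_pow[symmetric] using assms lam
      by (intro sums_sum nonarch_sums_mult deg_exp_sums) (auto intro: order_trans[OF vabs_of_nat_le_1])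
    \<comment> \<open>A geometric sum with ratio \<open>- w\<close>; since \<open>p ^ N\<close> is
      odd, the boundary term enters with a plus sign.\<close>
    moreover have "(\<Sum>x<M. (- 1) ^ x * w ^ x) * (w + 1) = 1 - (- 1) ^ M * w ^ M" for M
      by (induction M) (auto simp: algebra_simps)
    hence "(\<Sum>x<p ^ N. (- 1) ^ x * w ^ x) * (w + 1) = 1 + w ^ (p ^ N)"
      using assms(1) by simp
    hence "(\<Sum>x<p ^ N. (- 1) ^ x * w ^ x) = (1 + w ^ (p ^ N)) / (w + 1)"
      using nz by (simp add: w_def nonzero_eq_divide_eq)
    moreover have "(\<Sum>x<p ^ N. (- 1) ^ x * (gen_falling (of_nat x) n lam * a ^ n / fact n))
      = ?s N n * (a ^ n / fact n)" for n
      unfolding sum_distrib_right by (intro sum.cong) auto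
    ultimately show ?thesis by simp
  qed
  have bound: "vabs (?s N n * (a ^ n / fact n)) \<le> q ^ n" for N n
  proof -
    \<comment> \<open>The ultrametric inequality makes the number of summands irrelevant, which
      gives uniformity in \<open>N\<close>; \<open>lam ^ n\<close> then joins
      \<open>a ^ n / fact n\<close> to form an exponential term at \<open>lam * a\<close>.\<close>
    have "vabs (?s N n) \<le> vabs lam ^ n"
      using vabs_gen_falling_le[OF assms(2)]
      by (intro vabs_sum_le) (auto simp: vabs_mult vabs_power)
    hence "vabs (?s N n * (a ^ n / fact n)) \<le> vabs lam ^ n * vabs (a ^ n / fact n)"
      unfolding vabs_mult by (intro mult_right_mono) auto
    also have "\<dots> = vabs ((lam * a) ^ n / fact n)"
      by (simp add: vabs_mult vabs_divide vabs_power power_mult_distrib)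
    also have "\<dots> \<le> q ^ n" using r_pos by (intro vabs_exp_term) (simp add: q_def)
    finally show ?thesis .
  qed
  have g: "(\<lambda>n. q ^ n) \<longlonglongrightarrow> 0"
    using assms r_pos by (intro LIMSEQ_power_zero) (auto simp: q_def)
  have lim: "(\<lambda>N. ?s N n * (a ^ n / fact n)) \<longlonglongrightarrow> deg_euler p lam n * (a ^ n / fact n)" for n
    by (intro tendsto_mult deg_euler_LIMSEQ assms tendsto_const)
  note tannery = nonarch_tannery[OF sums bound g lim]
  \<comment> \<open>The quotient is written as a product with a constant so that continuity of
    multiplication suffices.\<close>
  have "(\<lambda>N. (1 + w ^ (p ^ N)) * (1 / (w + 1))) \<longlonglongrightarrow> (1 + 1) * (1 / (w + 1))"
    by (intro tendsto_mult tendsto_add tendsto_const w_lim)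
  hence "(\<Sum>n. deg_euler p lam n * (a ^ n / fact n)) = 2 / (w + 1)"
    using LIMSEQ_unique[OF tannery(2)] by simp
  thus "(\<lambda>n. deg_euler p lam n * a ^ n / fact n) sums (2 / (deg_exp lam 1 a + 1))"
    using summable_sums[OF tannery(1)] by (simp add: w_def)
qed

text \<open>With \<open>v = padic_exp u\<close> the values at 1/2, -1/2 and 1 are \<open>v\<close>,
  \<open>1 / v\<close> and \<open>v * v\<close>, so the quotient is
  \<open>(v * v - 1) / (v * v + 1)\<close>. Oddness of \<open>p\<close> makes 1/2 a unit and keeps
  \<open>u\<close> in the disc.\<close>

lemma deg_tanh_half:
  fixes lam a :: 'a
  assumes "odd p" "vabs lam \<ge> 1" "vabs (lam * a) < r"
  shows "deg_tanh lam (1 / 2) a = 1 - 2 / (deg_exp lam 1 a + 1)"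
proof -
  define u where "u = 1 / 2 / lam * padic_log (1 + lam * a)"
  have "vabs u \<le> 1 * vabs (lam * a)"
    unfolding u_def vabs_mult[of "1 / 2 / lam"] using assms vabs_two padic_log_eval(2)[OF assms(3)]
    by (intro mult_mono) (auto simp: vabs_divide vabs_mult divide_le_eq_1)
  hence u: "vabs u < r" using assms by simp
  have "padic_exp u * padic_exp (- u) = 1"
    using padic_exp_add[of u "- u"] u by (simp add: padic_exp_0)
  hence nz: "padic_exp u \<noteq> 0" and inv: "padic_exp (- u) = 1 / padic_exp u"
    by (auto simp: inverse_unique simp flip: inverse_eq_divide)
  have "deg_exp lam 1 a = padic_exp (u + u)"
    by (simp add: deg_exp_def u_def field_simps)
  hence sq: "deg_exp lam 1 a = padic_exp u * padic_exp u"
    using padic_exp_add[OF u u] by simp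
  have half: "deg_exp lam (1 / 2) a = padic_exp u" "deg_exp lam (- (1 / 2)) a = 1 / padic_exp u"
    using inv by (simp_all add: deg_exp_def u_def)
  have nz': "deg_exp lam 1 a + 1 \<noteq> 0"
    by (rule deg_euler_generating_function(2)[OF assms])
  have "padic_exp u - 1 / padic_exp u = (deg_exp lam 1 a - 1) / padic_exp u"
    "padic_exp u + 1 / padic_exp u = (deg_exp lam 1 a + 1) / padic_exp u"
    using nz by (simp_all add: sq field_simps)
  hence "deg_tanh lam (1 / 2) a = (deg_exp lam 1 a - 1) / (deg_exp lam 1 a + 1)"
    using nz by (simp add: deg_tanh_def deg_sinh_def deg_cosh_def half)
  also have "\<dots> = 1 - 2 / (deg_exp lam 1 a + 1)"
    using nz' by (simp add: field_simps)
  finally show ?thesis .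
qed

end

theorem theorem7:
  fixes p :: nat and lam a :: "'a::nonarch_complete_field"
  assumes "prime p" and "odd p"
    and "padic_complex p TYPE('a)"
    and "vabs lam \<ge> 1"
    and "a \<in> {t. lam * t \<in> padic_E p}"
  shows "(\<lambda>n. deg_euler p lam (Suc n) * a ^ Suc n / fact (Suc n))
           sums (- deg_tanh lam (1 / 2) a)"
proof -
  interpret padic_valued p "real p powr (- 1 / (real p - 1))" "TYPE('a)"
    using assms by unfold_locales (auto simp: padic_complex_def)
  have b: "vabs (lam * a) < real p powr (- 1 / (real p - 1))"
    using assms by (simp add: padic_E_def)
  show ?thesis
    \<comment> \<open>Dropping the term at 0, which is 1 by \<open>deg_euler_0\<close>, leaves
      \<open>2 / (deg_exp lam 1 a + 1) - 1\<close>.\<close>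
    using nonarch_sums_Suc[OF deg_euler_generating_function(1)[OF assms(2,4) b]]
    by (simp add: deg_tanh_half[OF assms(2,4) b] deg_euler_0[OF assms(2)])
qed

end
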